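(* Let $x=(x_1,x_2,\dots,x_n)$ be a binary sequence of length $n>33$ with $x_1=1$ whose first $33$ elements have run length encoding $(5,5,10,5,4,4)$. Put $p=5$, $t=16$, and $z_j=x_{p(j-1)+1}$, so that $z=(1,-1,1,1,-1,1,-1,\dots)$. Then $x_i=1$ for $1\le i\le p$, $x_{p+1}=-1$, and $x$ satisfies equation $(k)$ for all $1\le k\le t=16$, but $z$ does not satisfy equation $(k)$ for $k=3$, although $3\le\frac{t}{p}=3.2$.
   Context: A binary sequence of length $n$ is $x=(x_1,\dots,x_n)$ with each $x_i\in\{-1,1\}$. For $1\le k<\frac{n-1}{2}$, the sequence $x$ is said to satisfy equation $(k)$ if $$\frac{1+(-1)^{k+1}}{2}=\sum_{i=1}^{k}(-1)^{i+1}x_i x_{2k+2-i}.$$ Whether equation $(k)$ holds depends only on the first $2k+1$ elements of the sequence, so for the sequence $z$ the equation $(k)$ is to be read as this identity with $z_1,\dots,z_{2k+1}$ in place of $x_1,\dots,x_{2k+1}$. The run length encoding of a finite sequence is the list of the lengths of its successive maximal blocks of equal consecutive elements. *)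

theory Defs
  imports Complex_Main
begin

(* A sequence (x_1, ..., x_n) is a function on nat of which only the values at 1, ..., n matter. *)

definition binary_seq :: "nat \<Rightarrow> (nat \<Rightarrow> int) \<Rightarrow> bool" where
  "binary_seq n x \<longleftrightarrow> (\<forall>i\<in>{1..n}. x i \<in> {-1, 1})"

(* The bare identity; it mentions only x_1, ..., x_(2k+1). *)
definition equation :: "(nat \<Rightarrow> int) \<Rightarrow> nat \<Rightarrow> bool" where
  "equation x k \<longleftrightarrow>
     (1 + (-1) ^ (k + 1)) / 2 = real_of_int (\<Sum>i=1..k. (-1) ^ (i + 1) * x i * x (2 * k + 2 - i))"

(* For a sequence of length n, equation (k) is only considered when 1 <= k < (n - 1) / 2. *)
definition satisfies_equation :: "nat \<Rightarrow> (nat \<Rightarrow> int) \<Rightarrow> nat \<Rightarrow> bool" where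
  "satisfies_equation n x k \<longleftrightarrow> 1 \<le> k \<and> real k < (real n - 1) / 2 \<and> equation x k"

function run_lengths :: "'a list \<Rightarrow> nat list" where
  "run_lengths [] = []"
| "run_lengths (a # as) =
     length (takeWhile (\<lambda>b. b = a) (a # as)) # run_lengths (dropWhile (\<lambda>b. b = a) (a # as))"
  by pat_completeness auto
termination
  by (relation "measure length") (auto simp: le_imp_less_Suc length_dropWhile_le)

end

theory Submission
  imports Defs
begin

text \<open>A sequence over {-1, 1} is determined by its first entry and its run lengths, since the
  sign must flip from each block to the next (\<open>alternating_runs_run_lengths\<close>). So the
  hypotheses fix x_1, ..., x_33 completely. Equation (k) with k \<le> 16 reads no index beyond 2k +
  1 \<le> 33, and z_1, ..., z_7 are the entries of x at 1, 6, ..., 31; everything claimed is thus a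
  finite evaluation. For k = 3, the sum for z is -1 + 1 - 1 = -1, whereas the left-hand side is
  1.\<close>

primrec alternating_runs :: "'a::group_add \<Rightarrow> nat list \<Rightarrow> 'a list" where
  "alternating_runs a [] = []"
| "alternating_runs a (r # rs) = replicate r a @ alternating_runs (- a) rs"

lemma takeWhile_eq_replicate:
  "takeWhile (\<lambda>b. b = a) xs = replicate (length (takeWhile (\<lambda>b. b = a) xs)) a"
  by (induction xs) auto

text \<open>Induction over blocks: what remains after the first block starts with a value different
  from \<open>a\<close>, and with only two values available this is \<open>- a\<close>. This inverts
  \<open>run_lengths\<close>, turning the hypothesis on the encoding into an explicit list.\<close>

lemma alternating_runs_run_lengths:
  fixes xs :: "int list"
  assumes "set xs \<subseteq> {-1, 1}" and "xs \<noteq> []"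
  shows "alternating_runs (hd xs) (run_lengths xs) = xs"
  using assms
proof (induction xs rule: run_lengths.induct)
  case 1
  then show ?case by simp
next
  case (2 a as)
  let ?r = "takeWhile (\<lambda>b. b = a) (a # as)" and ?ys = "dropWhile (\<lambda>b. b = a) (a # as)"
  have sub: "set ?ys \<subseteq> {-1, 1}"
    using "2.prems"(1) set_dropWhileD by fastforce
  have "alternating_runs (- a) (run_lengths ?ys) = ?ys"
  \<comment> \<open>For the last block nothing remains, so there is no head to compare with
    \<open>- a\<close>.\<close>
  proof (cases "?ys = []")
    case True
    then show ?thesis
      by (simp only: run_lengths.simps alternating_runs.simps)
  next
    case False
    have "hd ?ys \<noteq> a"
      by (rule hd_dropWhile[OF False])
    moreover have "hd ?ys \<in> {-1, 1}"
      by (rule subsetD[OF sub list.set_sel(1)[OF False]])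
    moreover have "a \<in> {-1, 1}"
      using "2.prems"(1) by simp
    ultimately have "hd ?ys = - a"
      by (metis add.inverse_inverse insertE singletonD)
    with "2.IH"[OF sub False] show ?thesis by simp
  qed
  moreover have "replicate (length ?r) a = ?r"
    by (rule takeWhile_eq_replicate[symmetric])
  ultimately have "alternating_runs a (length ?r # run_lengths ?ys) = ?r @ ?ys"
    by (simp only: alternating_runs.simps)
  then show ?case
    by (simp only: run_lengths.simps list.sel takeWhile_dropWhile_id)
qed

theorem mainTheorem2:
  fixes n p t :: nat and x z :: "nat \<Rightarrow> int"
  assumes "n > 33"
    and "binary_seq n x"
    and "x 1 = 1"
    and "run_lengths (map x [1..<34]) = [5, 5, 10, 5, 4, 4]"
    and "p = 5"
    and "t = 16"
    and "\<And>j. 1 \<le> j \<Longrightarrow> p * (j - 1) + 1 \<le> n \<Longrightarrow> z j = x (p * (j - 1) + 1)"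
  shows "map z [1..<8] = [1, -1, 1, 1, -1, 1, -1]
    \<and> (\<forall>i. 1 \<le> i \<and> i \<le> p \<longrightarrow> x i = 1)
    \<and> x (p + 1) = -1
    \<and> (\<forall>k. 1 \<le> k \<and> k \<le> t \<longrightarrow> satisfies_equation n x k)
    \<and> \<not> equation z 3
    \<and> 3 \<le> real t / real p
    \<and> real t / real p = 3.2"
proof -
  have "set (map x [1..<34]) \<subseteq> {-1, 1}"
    using assms(1,2) by (auto simp: binary_seq_def)
  moreover have "hd (map x [1..<34]) = 1"
    using assms(3) by (simp add: hd_map)
  ultimately have runs: "map x [1..<34] = alternating_runs 1 [5, 5, 10, 5, 4, 4]"
    using alternating_runs_run_lengths[of "map x [1..<34]"] assms(4) by simp
  \<comment> \<open>List positions start at 0, the sequence at 1. The \<open>Suc\<close> form serves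
    as a rewrite rule once numerals are unfolded by \<open>numeral_eq_Suc\<close>.\<close>
  have x_Suc: "x (Suc i) = alternating_runs 1 [5, 5, 10, 5, 4, 4] ! i" if "i < 33" for i
    using arg_cong[OF runs, of "\<lambda>xs. xs ! i"] that by simp
  \<comment> \<open>The largest position used is 5 * 6 = 30, inside the known prefix.\<close>
  have z_Suc: "z (Suc j) = alternating_runs 1 [5, 5, 10, 5, 4, 4] ! (5 * j)" if "j < 7" for j
    using assms(1,5,7) that x_Suc[of "5 * j"] by simp
  have "satisfies_equation n x k" if k: "1 \<le> k" "k \<le> 16" for k
  proof -
    have "k \<in> {1, 2, 3, 4, 5, 6, 7, 8, 9, 10, 11, 12, 13, 14, 15, 16}"
      using k unfolding insert_iff empty_iff by presburger
    then have "equation x k"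
      by (elim insertE emptyE)
        (simp_all add: equation_def x_Suc numeral_eq_Suc sum.atLeast_Suc_atMost)
    \<comment> \<open>From n \<ge> 34 follows (n - 1) / 2 \<ge> 16.5 > k.\<close>
    with k assms(1) show ?thesis
      by (simp add: satisfies_equation_def)
  qed
  moreover have "\<forall>i. 1 \<le> i \<and> i \<le> p \<longrightarrow> x i = 1"
  proof (intro allI impI)
    fix i assume "1 \<le> i \<and> i \<le> p"
    then have "i \<in> {1, 2, 3, 4, 5}" using assms(5) by auto
    then show "x i = 1" by (auto simp: x_Suc numeral_eq_Suc)
  qed
  moreover have "map z [1..<8] = [1, -1, 1, 1, -1, 1, -1]"
    by (simp add: z_Suc upt_rec numeral_eq_Suc)
  moreover have "\<not> equation z 3"
    by (simp add: equation_def z_Suc numeral_eq_Suc sum.atLeast_Suc_atMost)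
  ultimately show ?thesis
    using assms(5,6) x_Suc[of 5] by (simp add: numeral_eq_Suc)
qed

end
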